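(* Let $X$ be an $n\times p$ design matrix with i.i.d. $\mathcal N(0,1/n)$ entries. Then, as long as $p>n\ge60\log p$, we have $\nu(X)\le\frac{\sqrt{15\log p}}{n}$ with probability exceeding $1-2p^{-2}$.
   Context: $\log$ is the natural logarithm. For an $n\times p$ matrix $X$ with columns $\mathrm x_1,\dots,\mathrm x_p$, the average coherence is $\nu(X)=\frac1{p-1}\max_i\big|\sum_{j\ne i}\langle\mathrm x_i,\mathrm x_j\rangle\big|$; here it is applied directly to the (unnormalized) columns of the Gaussian matrix. *)

theory Defs
  imports "HOL-Probability.Probability"
begin

text \<open>
  For \<open>X :: real^'p^'n\<close> the rows are indexed by \<open>'n\<close> and the columns by \<open>'p\<close>, so that
  \<open>column i X :: real^'n\<close> is the \<open>i\<close>-th column; the columns are not normalised.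
\<close>

definition average_coherence :: "real^'p^'n \<Rightarrow> real" where
  "average_coherence X =
     1 / (real CARD('p) - 1) *
     (MAX i. \<bar>\<Sum>j\<in>UNIV - {i}. column i X \<bullet> column j X\<bar>)"

end

theory Submission
  imports Defs
begin

text \<open>
  Write \<open>n\<close>, \<open>p\<close> for the two dimensions and \<open>L = ln p\<close>. The sum
  \<open>S = (\<Sum>j\<noteq>i. \<langle>x\<^sub>i, x\<^sub>j\<rangle>)\<close> is the single inner product \<open>\<langle>x\<^sub>i, y\<rangle>\<close>, where
  \<open>y\<close> is the sum of the columns other than \<open>x\<^sub>i\<close>. Row by row, it is a sum of \<open>n\<close>
  independent products of two independent centred Gaussians with variances \<open>1 / n\<close> and
  \<open>(p - 1) / n\<close>. The moment generating function of such a product is explicit (integrate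
  out one factor, then the other), and independence of the rows gives
  \<open>E (exp (l * S)) = (1 - s) powr (- n / 2)\<close> with \<open>s = l\<^sup>2 * (p - 1) / n\<^sup>2\<close>; this is
  \<open>normal_column_inner_exp_moment\<close>.

  A Chernoff bound at the level \<open>t = (p - 1) * sqrt (15 * L) / n\<close>, with \<open>l\<close> chosen so that
  \<open>s = 15 * L / n\<close>, then has exponent \<open>- l * t + n * s / (2 * (1 - s))\<close>. The hypothesis
  \<open>n \<ge> 60 * L\<close> says \<open>s \<le> 1 / 4\<close>, so the second term is at most \<open>10 * L\<close>, and
  \<open>p - 1 \<ge> n\<close> makes \<open>l * t = 15 * L * sqrt ((p - 1) / n)\<close> at least \<open>15 * L\<close>. Hence each
  one-sided tail has probability at most \<open>exp (- 5 * L) = 1 / p ^ 5\<close>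
  (\<open>normal_column_inner_tail\<close>), and the union bound over the two signs and the \<open>p\<close> columns
  costs \<open>2 / p ^ 4\<close>, which is less than \<open>2 / p\<^sup>2\<close>.
\<close>

section \<open>Exponential moments of Gaussians\<close>

text \<open>Completing the square: exponential tilting of a centred Gaussian moves its mean.\<close>

lemma normal_density_tilt:
  assumes "\<sigma> > 0"
  shows "normal_density 0 \<sigma> x * exp (a * x)
           = exp (a\<^sup>2 * \<sigma>\<^sup>2 / 2) * normal_density (a * \<sigma>\<^sup>2) \<sigma> x"
proof -
  have "- x\<^sup>2 / (2 * \<sigma>\<^sup>2) + a * x = a\<^sup>2 * \<sigma>\<^sup>2 / 2 + - (x - a * \<sigma>\<^sup>2)\<^sup>2 / (2 * \<sigma>\<^sup>2)"
    using assms by (simp add: field_simps power2_eq_square)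
  then show ?thesis
    unfolding normal_density_def by (simp add: exp_add [symmetric])
qed

lemma nn_integral_normal_density:
  assumes "\<sigma> > 0"
  shows "(\<integral>\<^sup>+x. ennreal (normal_density \<mu> \<sigma> x) \<partial>lborel) = 1"
  using prob_space.emeasure_space_1 [OF prob_space_normal_density [OF assms, of \<mu>]]
  by (simp add: emeasure_density)

lemma normal_exp_moment:
  assumes "\<sigma> > 0"
  shows "(\<integral>\<^sup>+x. ennreal (normal_density 0 \<sigma> x) * ennreal (exp (a * x)) \<partial>lborel)
           = ennreal (exp (a\<^sup>2 * \<sigma>\<^sup>2 / 2))"
proof -
  have "(\<integral>\<^sup>+x. ennreal (normal_density 0 \<sigma> x) * ennreal (exp (a * x)) \<partial>lborel)
      = (\<integral>\<^sup>+x. ennreal (exp (a\<^sup>2 * \<sigma>\<^sup>2 / 2)) * ennreal (normal_density (a * \<sigma>\<^sup>2) \<sigma> x) \<partial>lborel)"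
    by (simp add: ennreal_mult [symmetric] normal_density_tilt [OF assms])
  also have "\<dots> = ennreal (exp (a\<^sup>2 * \<sigma>\<^sup>2 / 2))"
    by (simp add: nn_integral_cmult nn_integral_normal_density [OF assms])
  finally show ?thesis .
qed

text \<open>
  A quadratic exponential turns a Gaussian density into a multiple of another one, of the larger
  standard deviation \<open>\<sigma> / sqrt (1 - b * \<sigma>\<^sup>2)\<close>; the multiple is the ratio of the two normalising
  constants.
\<close>

lemma normal_exp_square_moment:
  assumes \<sigma>: "\<sigma> > 0" and b: "b * \<sigma>\<^sup>2 < 1"
  shows "(\<integral>\<^sup>+x. ennreal (normal_density 0 \<sigma> x) * ennreal (exp (b * x\<^sup>2 / 2)) \<partial>lborel)
           = ennreal (1 / sqrt (1 - b * \<sigma>\<^sup>2))"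
proof -
  define c where "c = sqrt (1 - b * \<sigma>\<^sup>2)"
  have c: "c > 0" and c2: "c\<^sup>2 = 1 - b * \<sigma>\<^sup>2"
    using b by (auto simp: c_def)
  have "normal_density 0 \<sigma> x * exp (b * x\<^sup>2 / 2) = 1 / c * normal_density 0 (\<sigma> / c) x" for x
  proof -
    have "- x\<^sup>2 / (2 * \<sigma>\<^sup>2) + b * x\<^sup>2 / 2 = - x\<^sup>2 * (1 - b * \<sigma>\<^sup>2) / (2 * \<sigma>\<^sup>2)"
      using \<sigma> by (simp add: field_simps)
    also have "\<dots> = - x\<^sup>2 / (2 * (\<sigma> / c)\<^sup>2)"
      using \<sigma> c by (simp add: c2 [symmetric] field_simps)
    finally show ?thesis
      using \<sigma> c
      by (simp add: normal_density_def exp_add [symmetric] real_sqrt_mult real_sqrt_divide power_divide)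
  qed
  then have "(\<integral>\<^sup>+x. ennreal (normal_density 0 \<sigma> x) * ennreal (exp (b * x\<^sup>2 / 2)) \<partial>lborel)
      = (\<integral>\<^sup>+x. ennreal (1 / c) * ennreal (normal_density 0 (\<sigma> / c) x) \<partial>lborel)"
    using c by (simp add: ennreal_mult [symmetric])
  also have "\<dots> = ennreal (1 / c)"
    using \<sigma> c by (simp add: nn_integral_cmult nn_integral_normal_density)
  finally show ?thesis by (simp add: c_def)
qed

text \<open>
  Given \<open>U\<close>, the exponent is linear in \<open>V\<close>, and averaging over \<open>V\<close> leaves
  \<open>exp ((l * U)\<^sup>2 * \<tau>\<^sup>2 / 2)\<close>, whose expectation is a quadratic exponential moment of \<open>U\<close>.
  Nonnegative integrals let Tonelli's theorem do this with no integrability side conditions.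
\<close>

lemma (in prob_space) indep_normal_product_exp_moment:
  assumes ind: "indep_var borel U borel V"
    and U: "distributed M lborel U (normal_density 0 \<sigma>)"
    and V: "distributed M lborel V (normal_density 0 \<tau>)"
    and pos: "\<sigma> > 0" "\<tau> > 0" and small: "l\<^sup>2 * \<sigma>\<^sup>2 * \<tau>\<^sup>2 < 1"
  shows "(\<integral>\<^sup>+\<omega>. ennreal (exp (l * (U \<omega> * V \<omega>))) \<partial>M)
           = ennreal (1 / sqrt (1 - l\<^sup>2 * \<sigma>\<^sup>2 * \<tau>\<^sup>2))"
proof -
  have [measurable]: "random_variable borel U" "random_variable borel V"
    using ind by (auto dest: indep_var_rv1 indep_var_rv2)
  have V_moment: "(\<integral>\<^sup>+\<omega>. ennreal (exp (a * V \<omega>)) \<partial>M) = ennreal (exp (a\<^sup>2 * \<tau>\<^sup>2 / 2))" for a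
    by (subst distributed_nn_integral [OF V, symmetric])
      (simp_all add: normal_exp_moment [OF pos(2)])
  interpret V: prob_space "distr M borel V" by (rule prob_space_distr) simp
  have joint: "distr M (borel \<Otimes>\<^sub>M borel) (\<lambda>\<omega>. (U \<omega>, V \<omega>)) = distr M borel U \<Otimes>\<^sub>M distr M borel V"
    using ind by (simp add: indep_var_distribution_eq)
  have "(\<integral>\<^sup>+\<omega>. ennreal (exp (l * (U \<omega> * V \<omega>))) \<partial>M)
      = (\<integral>\<^sup>+z. ennreal (exp (l * (fst z * snd z))) \<partial>distr M (borel \<Otimes>\<^sub>M borel) (\<lambda>\<omega>. (U \<omega>, V \<omega>)))"
    by (subst nn_integral_distr) simp_all
  also have "\<dots> = (\<integral>\<^sup>+u. \<integral>\<^sup>+v. ennreal (exp (l * (u * v))) \<partial>distr M borel V \<partial>distr M borel U)"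
    unfolding joint by (subst V.nn_integral_fst [symmetric]) simp_all
  also have "\<dots> = (\<integral>\<^sup>+\<omega>. \<integral>\<^sup>+\<omega>'. ennreal (exp ((l * U \<omega>) * V \<omega>')) \<partial>M \<partial>M)"
    by (simp add: nn_integral_distr mult.assoc)
  also have "\<dots> = (\<integral>\<^sup>+\<omega>. ennreal (exp ((l * U \<omega>)\<^sup>2 * \<tau>\<^sup>2 / 2)) \<partial>M)"
    by (simp only: V_moment)
  also have "\<dots> = (\<integral>\<^sup>+\<omega>. ennreal (exp (l\<^sup>2 * \<tau>\<^sup>2 * (U \<omega>)\<^sup>2 / 2)) \<partial>M)"
    by (simp add: power_mult_distrib mult_ac)
  also have "\<dots> = ennreal (1 / sqrt (1 - l\<^sup>2 * \<tau>\<^sup>2 * \<sigma>\<^sup>2))"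
    using small normal_exp_square_moment [OF pos(1), of "l\<^sup>2 * \<tau>\<^sup>2"]
    by (subst distributed_nn_integral [OF U, symmetric]) (simp_all add: mult_ac)
  finally show ?thesis by (simp add: mult_ac)
qed

section \<open>Inner product of one column with a sum of others\<close>

text \<open>
  Each row \<open>k\<close> contributes the product of \<open>X k i\<close> and an independent Gaussian of variance
  \<open>card J * \<sigma>\<^sup>2\<close>. Distinct rows use disjoint sets of entries, so these contributions are
  independent and their exponential moments multiply.
\<close>

lemma (in prob_space) normal_column_inner_exp_moment:
  fixes X :: "'k::finite \<Rightarrow> 'j::finite \<Rightarrow> 'a \<Rightarrow> real"
  assumes ind: "indep_vars (\<lambda>_. borel) (\<lambda>(k, j). X k j) UNIV"
    and normal: "\<And>k j. distributed M lborel (X k j) (normal_density 0 \<sigma>)"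
    and \<sigma>: "\<sigma> > 0" and J: "i \<notin> J" "J \<noteq> {}"
    and small: "l\<^sup>2 * \<sigma> ^ 4 * real (card J) < 1"
  shows "(\<integral>\<^sup>+\<omega>. ennreal (exp (l * (\<Sum>k\<in>UNIV. X k i \<omega> * (\<Sum>j\<in>J. X k j \<omega>)))) \<partial>M)
           = ennreal ((1 / sqrt (1 - l\<^sup>2 * \<sigma> ^ 4 * real (card J))) ^ CARD('k))"
proof -
  have rv [measurable]: "random_variable borel (X k j)" for k j
    using distributed_measurable [OF normal] by simp
  have row_moment: "(\<integral>\<^sup>+\<omega>. ennreal (exp (l * (X k i \<omega> * (\<Sum>j\<in>J. X k j \<omega>)))) \<partial>M)
      = ennreal (1 / sqrt (1 - l\<^sup>2 * \<sigma> ^ 4 * real (card J)))" for k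
  proof -
    let ?A = "{(k, i)}" and ?B = "{k} \<times> J"
    have "indep_var (PiM ?A (\<lambda>_. borel)) (\<lambda>\<omega>. restrict (\<lambda>q. (case q of (k, j) \<Rightarrow> X k j) \<omega>) ?A)
                    (PiM ?B (\<lambda>_. borel)) (\<lambda>\<omega>. restrict (\<lambda>q. (case q of (k, j) \<Rightarrow> X k j) \<omega>) ?B)"
      using J by (intro indep_var_restrict [OF ind]) auto
    from indep_var_compose [OF this, of "\<lambda>f. f (k, i)" borel "\<lambda>f. \<Sum>j\<in>J. f (k, j)" borel]
    have "indep_var borel (X k i) borel (\<lambda>\<omega>. \<Sum>j\<in>J. X k j \<omega>)"
      by (simp add: comp_def)
    moreover
    have "indep_vars (\<lambda>j. PiM {(k, j)} (\<lambda>_. borel))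
        (\<lambda>j \<omega>. restrict (\<lambda>q. (case q of (k, j) \<Rightarrow> X k j) \<omega>) {(k, j)}) J"
      by (intro indep_vars_restrict [OF ind]) (auto simp: disjoint_family_on_def)
    from indep_vars_compose2 [OF this, of "\<lambda>j f. f (k, j)" "\<lambda>_. borel"]
    have "indep_vars (\<lambda>_. borel) (X k) J"
      by simp
    then have "distributed M lborel (\<lambda>\<omega>. \<Sum>j\<in>J. X k j \<omega>)
        (normal_density 0 (sqrt (real (card J) * \<sigma>\<^sup>2)))"
      using sum_indep_normal [of J "X k" "\<lambda>_. \<sigma>" "\<lambda>_. 0"] J \<sigma> normal by simp
    moreover have "card J > 0"
      using J by (simp add: card_gt_0_iff)
    ultimately show ?thesis
      using indep_normal_product_exp_moment [of "X k i" "\<lambda>\<omega>. \<Sum>j\<in>J. X k j \<omega>" \<sigma>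
          "sqrt (real (card J) * \<sigma>\<^sup>2)" l] normal \<sigma> small
      by (simp add: power4_eq_xxxx power2_eq_square mult_ac)
  qed
  have exp_sum_eq: "ennreal (exp (l * (\<Sum>k\<in>UNIV. f k))) = (\<Prod>k\<in>UNIV. ennreal (exp (l * f k)))"
    for f :: "'k \<Rightarrow> real"
    by (simp add: sum_distrib_left exp_sum prod_ennreal)
  let ?K = "\<lambda>k. {k} \<times> (UNIV :: 'j set)"
  have "indep_vars (\<lambda>k. PiM (?K k) (\<lambda>_. borel))
      (\<lambda>k \<omega>. restrict (\<lambda>q. (case q of (k, j) \<Rightarrow> X k j) \<omega>) (?K k)) UNIV"
    by (intro indep_vars_restrict [OF ind]) (auto simp: disjoint_family_on_def)
  from indep_vars_compose2 [OF this,
      of "\<lambda>k f. ennreal (exp (l * (f (k, i) * (\<Sum>j\<in>J. f (k, j)))))" "\<lambda>_. borel"]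
  have rows: "indep_vars (\<lambda>_. borel)
      (\<lambda>k \<omega>. ennreal (exp (l * (X k i \<omega> * (\<Sum>j\<in>J. X k j \<omega>))))) UNIV"
    by simp
  have "(\<integral>\<^sup>+\<omega>. ennreal (exp (l * (\<Sum>k\<in>UNIV. X k i \<omega> * (\<Sum>j\<in>J. X k j \<omega>)))) \<partial>M)
      = (\<integral>\<^sup>+\<omega>. (\<Prod>k\<in>UNIV. ennreal (exp (l * (X k i \<omega> * (\<Sum>j\<in>J. X k j \<omega>))))) \<partial>M)"
    by (simp only: exp_sum_eq)
  also have "\<dots> = (\<Prod>k\<in>(UNIV :: 'k set). ennreal (1 / sqrt (1 - l\<^sup>2 * \<sigma> ^ 4 * real (card J))))"
    by (subst indep_vars_nn_integral [OF _ rows]) (simp_all only: row_moment finite zero_le)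
  also have "\<dots> = ennreal ((1 / sqrt (1 - l\<^sup>2 * \<sigma> ^ 4 * real (card J))) ^ CARD('k))"
    using small by (simp add: ennreal_power)
  finally show ?thesis .
qed

section \<open>Tail bound for the inner product\<close>

text \<open>Follows from \<open>1 / (1 - s) = 1 + s / (1 - s) \<le> exp (s / (1 - s))\<close>.\<close>

lemma inverse_sqrt_power_le_exp:
  assumes "0 \<le> s" "s < 1"
  shows "(1 / sqrt (1 - s)) ^ n \<le> exp (real n * s / (2 * (1 - s)))"
proof -
  have "1 / (1 - s) = 1 + s / (1 - s)"
    using assms by (simp add: field_simps)
  also have "\<dots> \<le> exp (s / (1 - s))"
    by (rule exp_ge_add_one_self)
  also have "\<dots> = (exp (s / (2 * (1 - s))))\<^sup>2"
    using assms by (simp add: exp_double [symmetric] field_simps)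
  finally have "1 / sqrt (1 - s) \<le> exp (s / (2 * (1 - s)))"
    using assms by (metis exp_ge_zero real_le_lsqrt real_sqrt_divide real_sqrt_one)
  then have "(1 / sqrt (1 - s)) ^ n \<le> exp (s / (2 * (1 - s))) ^ n"
    using assms by (intro power_mono) auto
  also have "\<dots> = exp (real n * s / (2 * (1 - s)))"
    by (simp add: exp_of_nat_mult [symmetric])
  finally show ?thesis .
qed

lemma (in prob_space) prob_ge_le_exp_moment:
  assumes [measurable]: "random_variable borel S" and l: "l > 0"
    and moment: "(\<integral>\<^sup>+\<omega>. ennreal (exp (l * S \<omega>)) \<partial>M) = ennreal B" "B \<ge> 0"
  shows "prob {\<omega> \<in> space M. S \<omega> \<ge> t} \<le> exp (- l * t) * B"
proof -
  have "emeasure M {\<omega> \<in> space M. S \<omega> \<ge> t}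
      \<le> ennreal (exp (- l * t)) * (\<integral>\<^sup>+\<omega>\<in>space M. ennreal (exp (l * S \<omega>)) \<partial>M)"
    by (rule Chernoff_ineq_nn_integral_ge) (use l in simp_all)
  also have "(\<integral>\<^sup>+\<omega>\<in>space M. ennreal (exp (l * S \<omega>)) \<partial>M)
      = (\<integral>\<^sup>+\<omega>. ennreal (exp (l * S \<omega>)) \<partial>M)"
    by (intro nn_integral_cong) simp
  finally show ?thesis
    using moment by (simp add: emeasure_eq_measure ennreal_mult [symmetric])
qed

text \<open>
  Here \<open>L\<close> stands for \<open>ln p\<close> and \<open>card J\<close> for \<open>p - 1\<close>. The exponential moment is even in the
  Chernoff parameter, so the lower tail obeys the same bound as the upper one.
\<close>

lemma (in prob_space) normal_column_inner_tail:
  fixes X :: "'k::finite \<Rightarrow> 'j::finite \<Rightarrow> 'a \<Rightarrow> real"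
  assumes ind: "indep_vars (\<lambda>_. borel) (\<lambda>(k, j). X k j) UNIV"
    and normal: "\<And>k j. distributed M lborel (X k j) (normal_density 0 (sqrt (1 / real CARD('k))))"
    and J: "i \<notin> J" "card J \<ge> CARD('k)"
    and L: "L > 0" "real CARD('k) \<ge> 60 * L"
  shows "prob {\<omega> \<in> space M. \<bar>\<Sum>k\<in>UNIV. X k i \<omega> * (\<Sum>j\<in>J. X k j \<omega>)\<bar>
            \<ge> real (card J) * (sqrt (15 * L) / real CARD('k))} \<le> 2 * exp (- 5 * L)"
proof -
  define n where "n = real CARD('k)"
  define m where "m = real (card J)"
  define S where "S = (\<lambda>\<omega>. \<Sum>k\<in>UNIV. X k i \<omega> * (\<Sum>j\<in>J. X k j \<omega>))"
  define t where "t = m * (sqrt (15 * L) / n)"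
  define s where "s = 15 * L / n"
  \<comment> \<open>The Chernoff parameter is the one for which the moment is \<open>(1 - s) powr (- n / 2)\<close>.\<close>
  define l where "l = sqrt (15 * L * n / m)"
  define B where "B = (1 / sqrt (1 - s)) ^ CARD('k)"
  have n: "n > 0" and mn: "m \<ge> n" and "J \<noteq> {}"
    using J by (auto simp: n_def m_def)
  then have m: "m > 0" by simp
  have s: "0 \<le> s" "s \<le> 1 / 4"
    using L n by (auto simp: s_def n_def field_simps)
  have l: "l > 0" and l2: "l\<^sup>2 * sqrt (1 / n) ^ 4 * m = s"
  proof -
    show "l > 0" using L n m by (simp add: l_def)
    have "sqrt (1 / n) ^ 4 = (1 / n)\<^sup>2"
      using n by (simp add: power4_eq_xxxx power2_eq_square)
    then show "l\<^sup>2 * sqrt (1 / n) ^ 4 * m = s"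
      using L n m by (simp add: l_def s_def power2_eq_square)
  qed
  have [measurable]: "random_variable borel (X k j)" for k j
    using distributed_measurable [OF normal] by simp
  have [measurable]: "random_variable borel S"
    unfolding S_def by measurable
  have moment: "(\<integral>\<^sup>+\<omega>. ennreal (exp (a * S \<omega>)) \<partial>M) = ennreal B" if "a\<^sup>2 = l\<^sup>2" for a
    using normal_column_inner_exp_moment [OF ind normal, of i J a] J(1) \<open>J \<noteq> {}\<close> that l2 s n
    by (simp add: S_def B_def n_def m_def)
  have "l * t \<ge> 15 * L"
  proof -
    have "l * t = sqrt (15 * L * n / m) * sqrt ((m / n)\<^sup>2) * sqrt (15 * L)"
      using n m by (simp add: l_def t_def)
    also have "\<dots> = sqrt ((15 * L * n / m) * (m / n)\<^sup>2 * (15 * L))"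
      by (simp only: real_sqrt_mult)
    also have "(15 * L * n / m) * (m / n)\<^sup>2 * (15 * L) = (15 * L)\<^sup>2 * (m / n)"
      using n m by (simp add: power2_eq_square)
    also have "sqrt \<dots> \<ge> sqrt ((15 * L)\<^sup>2 * 1)"
      using n mn by (intro real_sqrt_le_mono mult_left_mono) auto
    finally show ?thesis using L by (simp add: real_sqrt_mult)
  qed
  moreover have "B \<le> exp (10 * L)"
  proof -
    have "B \<le> exp (n * s / (2 * (1 - s)))"
      using inverse_sqrt_power_le_exp [of s "CARD('k)"] s by (simp add: B_def n_def)
    also have "n * s = 15 * L" using n by (simp add: s_def)
    also have "15 * L / (2 * (1 - s)) \<le> 15 * L / (2 * (1 - 1 / 4))"
      using s L by (intro divide_left_mono) auto
    finally show ?thesis by simp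
  qed
  moreover have B0: "B \<ge> 0" using s by (simp add: B_def)
  ultimately have "exp (- l * t) * B \<le> exp (- 15 * L) * exp (10 * L)"
    by (intro mult_mono) auto
  then have bound: "exp (- l * t) * B \<le> exp (- 5 * L)"
    by (simp add: exp_add [symmetric])
  have up: "prob {\<omega> \<in> space M. S \<omega> \<ge> t} \<le> exp (- 5 * L)"
    using prob_ge_le_exp_moment [of S l B t] moment [of l] l B0 bound by simp
  have down: "prob {\<omega> \<in> space M. - S \<omega> \<ge> t} \<le> exp (- 5 * L)"
    using prob_ge_le_exp_moment [of "\<lambda>\<omega>. - S \<omega>" l B t] moment [of "- l"] l B0 bound by simp
  have "prob {\<omega> \<in> space M. \<bar>S \<omega>\<bar> \<ge> t}
      = prob ({\<omega> \<in> space M. S \<omega> \<ge> t} \<union> {\<omega> \<in> space M. - S \<omega> \<ge> t})"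
    by (intro arg_cong [where f = prob]) auto
  also have "\<dots> \<le> prob {\<omega> \<in> space M. S \<omega> \<ge> t} + prob {\<omega> \<in> space M. - S \<omega> \<ge> t}"
    by (rule measure_Un_le) measurable
  also have "\<dots> \<le> 2 * exp (- 5 * L)"
    using up down by simp
  finally show ?thesis
    by (simp add: S_def t_def m_def n_def)
qed

section \<open>Average coherence\<close>

text \<open>
  Besides turning the bound on the maximum into one bound per column, this form exhibits the
  event as a finite intersection of events in the matrix entries, hence as measurable.
\<close>

lemma average_coherence_le_iff:
  fixes A :: "real^'p^'n"
  assumes "CARD('p) > 1"
  shows "average_coherence A \<le> r \<longleftrightarrow>
    (\<forall>i. \<bar>\<Sum>k\<in>UNIV. A $ k $ i * (\<Sum>j\<in>UNIV - {i}. A $ k $ j)\<bar> \<le> (real CARD('p) - 1) * r)"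
proof -
  have "(\<Sum>j\<in>UNIV - {i}. column i A \<bullet> column j A)
      = (\<Sum>k\<in>UNIV. A $ k $ i * (\<Sum>j\<in>UNIV - {i}. A $ k $ j))" for i
    unfolding inner_sum_right [symmetric] by (simp add: inner_vec_def column_def sum_component)
  then have "average_coherence A
      = (MAX i. \<bar>\<Sum>k\<in>UNIV. A $ k $ i * (\<Sum>j\<in>UNIV - {i}. A $ k $ j)\<bar>) / (real CARD('p) - 1)"
    by (simp add: average_coherence_def)
  then show ?thesis
    using assms by (simp add: divide_le_eq mult.commute)
qed

theorem lemma2:
  fixes M :: "'a measure" and X :: "'a \<Rightarrow> real^'p^'n"
  assumes "prob_space M"
    and "prob_space.indep_vars M (\<lambda>_. borel) (\<lambda>(k, j) \<omega>. X \<omega> $ k $ j) UNIV"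
    and "\<And>k j. distributed M lborel (\<lambda>\<omega>. X \<omega> $ k $ j)
                 (normal_density 0 (sqrt (1 / real CARD('n))))"
    and "CARD('p) > CARD('n)"
    and "real CARD('n) \<ge> 60 * ln (real CARD('p))"
  shows "measure M {\<omega> \<in> space M.
           average_coherence (X \<omega>) \<le> sqrt (15 * ln (real CARD('p))) / real CARD('n)}
         > 1 - 2 / (real CARD('p))\<^sup>2"
proof -
  interpret prob_space M by fact
  define p where "p = real CARD('p)"
  define r where "r = sqrt (15 * ln p) / real CARD('n)"
  define S where "S = (\<lambda>i \<omega>. \<Sum>k\<in>UNIV. X \<omega> $ k $ i * (\<Sum>j\<in>UNIV - {i}. X \<omega> $ k $ j))"
  define good where "good = {\<omega> \<in> space M. average_coherence (X \<omega>) \<le> r}"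
  define bad where "bad = (\<lambda>i. {\<omega> \<in> space M. \<bar>S i \<omega>\<bar> \<ge> (p - 1) * r})"
  have "CARD('n) > 0" by simp
  with assms(4) have card_p: "CARD('p) > 1" by linarith
  then have p: "p > 1" by (simp add: p_def)
  have card_others: "card (UNIV - {i :: 'p}) = CARD('p) - 1" for i
    by (simp add: card_Diff_singleton)
  have [measurable]: "random_variable borel (\<lambda>\<omega>. X \<omega> $ k $ j)" for k j
    using distributed_measurable [OF assms(3)] by simp
  have [measurable]: "random_variable borel (S i)" for i
    unfolding S_def by measurable
  have bad_sets: "bad i \<in> events" for i
    unfolding bad_def by measurable
  have good_eq: "good = {\<omega> \<in> space M. \<forall>i. \<bar>S i \<omega>\<bar> \<le> (p - 1) * r}"
    by (simp add: good_def S_def p_def average_coherence_le_iff [OF card_p])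
  have good_sets: "good \<in> events"
    unfolding good_eq by measurable
  have "prob (bad i) \<le> 2 / p ^ 5" for i
  proof -
    have "exp (- 5 * ln p) = 1 / p ^ 5"
    proof -
      have "exp (- 5 * ln p) = inverse (exp (real 5 * ln p))" by (simp add: exp_minus)
      also have "exp (real 5 * ln p) = p ^ 5"
        using p by (simp only: exp_of_nat_mult exp_ln)
      finally show ?thesis by (simp add: inverse_eq_divide)
    qed
    then show ?thesis
      using normal_column_inner_tail [of "\<lambda>k j \<omega>. X \<omega> $ k $ j" i "UNIV - {i}" "ln p"]
        assms(2-5) p card_p
      by (simp add: bad_def S_def r_def p_def card_others of_nat_diff split_def)
  qed
  then have "(\<Sum>i\<in>UNIV. prob (bad i)) \<le> p * (2 / p ^ 5)"
    using sum_bounded_above [of "UNIV :: 'p set" "\<lambda>i. prob (bad i)" "2 / p ^ 5"]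
    by (simp add: p_def)
  moreover have "prob (\<Union>i. bad i) \<le> (\<Sum>i\<in>UNIV. prob (bad i))"
    using bad_sets by (intro finite_measure_subadditive_finite) auto
  moreover have "1 - prob good \<le> prob (\<Union>i. bad i)"
  proof -
    have "1 - prob good = prob (space M - good)"
      using good_sets by (simp add: prob_compl)
    also have "\<dots> \<le> prob (\<Union>i. bad i)"
      using bad_sets by (intro finite_measure_mono) (auto simp: good_eq bad_def not_le intro: less_imp_le)
    finally show ?thesis .
  qed
  moreover have "p * (2 / p ^ 5) < 2 / p\<^sup>2"
  proof -
    have "p\<^sup>2 < p ^ 4" using p by (intro power_strict_increasing) auto
    then have "2 / p ^ 4 < 2 / p\<^sup>2" using p by (intro divide_strict_left_mono) auto
    also have "2 / p ^ 4 = p * (2 / p ^ 5)" using p by (simp add: eval_nat_numeral)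
    finally show ?thesis .
  qed
  ultimately have "prob good > 1 - 2 / p\<^sup>2" by linarith
  then show ?thesis by (simp add: good_def r_def p_def)
qed

end
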